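(* Let $n>1$ and assume $f:\mathbb{R}^N\to\mathbb{R}$ is convex, partially separable of degree $\omega\in\{1,\dots,n\}$, and has block Lipschitz gradient with constants $L_1,\dots,L_n>0$. Let $\Psi$ be a block-separable closed convex function, $F=f+\Psi$, $L=(L_1,\dots,L_n)$, and assume $\mu_F(L)=\mu_f(L)>0$. Consider the family of parallel coordinate descent methods with $\tau$-nice sampling, $\tau\in\{1,\dots,n\}$, applied to $\min_{x\in\mathbb{R}^N}F(x)$. Under the parallel computing model with $p\in\{1,\dots,n\}$ processors described in the context, the method with $\tau=p$ is optimal. That is, $\tau=p$ minimizes over $\tau\in\{1,\dots,n\}$ the total time $$T(\tau)=\left\lceil\frac\tau p\right\rceil\frac n\tau\,\beta(\tau)\,c,\qquad \beta(\tau)=1+\frac{(\omega-1)(\tau-1)}{n-1},$$ where $c>0$ is the constant, independent of $\tau$, given in the context.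
   Context: Blocks: $N=\sum_{i=1}^nN_i$; $I=[U_1,\dots,U_n]$ is the columnwise partition of the $N\times N$ identity with $U_i\in\mathbb{R}^{N\times N_i}$, and $x^{(i)}=U_i^Tx$. $\Psi(x)=\sum_{i=1}^n\Psi_i(x^{(i)})$ with $\Psi_i:\mathbb{R}^{N_i}\to\mathbb{R}\cup\{+\infty\}$ convex and closed. $F^*=\min F$. For each $i$ a positive definite $B_i\in\mathbb{R}^{N_i\times N_i}$ is fixed, $\|t\|_{(i)}=\langle B_it,t\rangle^{1/2}$, $\|s\|_{(i)}^*=\langle B_i^{-1}s,s\rangle^{1/2}$, $\|x\|_w=\left(\sum_iw_i\|x^{(i)}\|_{(i)}^2\right)^{1/2}$. Partial separability of degree $\omega$: $f=\sum_{J\in\mathcal{J}}f_J$ for a collection $\mathcal{J}$ of subsets of $\{1,\dots,n\}$ with $\max_{J\in\mathcal J}|J|\le\omega$, each $f_J$ smooth, convex and depending only on $x^{(i)}$, $i\in J$. Block Lipschitz gradient: $\|(f'(x+U_it))^{(i)}-(f'(x))^{(i)}\|_{(i)}^*\le L_i\|t\|_{(i)}$ for all $x\in\mathbb{R}^N$, all $i$, and all $t\in\mathbb{R}^{N_i}$. $\mu_\phi(w)\geq 0$ is the strong convexity parameter of $\phi$ with respect to $\|\cdot\|_w$: $\phi(y)\ge\phi(x)+\langle\phi'(x),y-x\rangle+\frac{\mu_\phi(w)}2\|y-x\|_w^2$ for all $x,y\in\operatorname{dom}\phi$ and any subgradient $\phi'(x)$. A $\tau$-nice sampling is a random subset of $\{1,\dots,n\}$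 distributed uniformly over all subsets of cardinality $\tau$. The parallel coordinate descent method (PCDM) with $\tau$-nice sampling draws iid $\tau$-nice samplings $S_k$ and iterates $x_{k+1}=x_k+\sum_{i\in S_k}U_ih_k^{(i)}$, where $h_k=\arg\min_h\{f(x_k)+\langle f'(x_k),h\rangle+\frac{\beta(\tau)}2\|h\|_L^2+\Psi(x_k+h)\}$. Parallel computing model: there are $p$ processors, each able to compute and apply the update of a single block in one unit of time. The method is synchronous (a new iteration starts only once the previous one is finished), so one iteration updating $\tau$ blocks takes $\lceil\tau/p\rceil$ units of time. The number of iterations is taken to be the complexity bound $\frac n\tau\beta(\tau)c$ sufficient for $\mathbf{P}(F(x_k)-F^*\le\epsilon)\ge1-\rho$, with $c=\frac1{\mu_F(L)}\log\frac{F(x_0)-F^*}{\epsilon\rho}$ independent of $\tau$ (for fixed $x_0\in\operatorname{dom}F$, $0<\epsilon<F(x_0)-F^*$, $\rho\in(0,1)$). Total time $T(\tau)$ is the product of time per iteration and number of iterations. *)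

theory Defs
  imports "HOL-Probability.Probability"
begin

text \<open>
  The space \<open>real ^ 'm\<close> plays the role of $\mathbb{R}^N$ with $N$ = \<open>CARD('m)\<close>. The partition of
  the columns of the identity into $U_1,\dots,U_n$ is a map \<open>blk\<close> from the coordinates onto
  \<open>{1..n}\<close>, so that $N_i$ is the number of coordinates that \<open>blk\<close> sends to \<open>i\<close>. Since the block
  dimensions differ, $\mathbb{R}^{N_i}$ is identified with its image under $U_i$, the subspace
  \<open>block_space blk i\<close>; under this identification $x^{(i)} = U_i^T x$ is \<open>block blk i x\<close>, and
  $U_i t$ is \<open>t\<close> itself.
\<close>

definition block_space :: "('m \<Rightarrow> nat) \<Rightarrow> nat \<Rightarrow> (real ^ 'm) set" where
  "block_space blk i = {t. \<forall>j. blk j \<noteq> i \<longrightarrow> t $ j = 0}"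

definition block :: "('m \<Rightarrow> nat) \<Rightarrow> nat \<Rightarrow> real ^ 'm \<Rightarrow> real ^ 'm" where
  "block blk i x = (\<chi> j. if blk j = i then x $ j else 0)"

text \<open>
  The matrices $B_1,\dots,B_n$ are the diagonal blocks of one block-diagonal matrix \<open>B\<close>. On
  \<open>block_space blk i\<close> the matrix \<open>B\<close> acts as $B_i$ and \<open>matrix_inv B\<close> as $B_i^{-1}$, so the two
  norms below restrict there to $\|\cdot\|_{(i)}$ and $\|\cdot\|_{(i)}^*$.
\<close>

definition block_positive_definite :: "nat \<Rightarrow> ('m \<Rightarrow> nat) \<Rightarrow> real ^ 'm ^ 'm \<Rightarrow> bool" where
  "block_positive_definite n blk B \<longleftrightarrow>
     (\<forall>j k. blk j \<noteq> blk k \<longrightarrow> B $ j $ k = 0) \<and>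
     transpose B = B \<and>
     (\<forall>i\<in>{1..n}. \<forall>t\<in>block_space blk i. t \<noteq> 0 \<longrightarrow> 0 < (B *v t) \<bullet> t)"

definition block_norm :: "real ^ 'm ^ 'm \<Rightarrow> real ^ 'm \<Rightarrow> real" where
  "block_norm B t = sqrt ((B *v t) \<bullet> t)"

definition block_dual_norm :: "real ^ 'm ^ 'm \<Rightarrow> real ^ 'm \<Rightarrow> real" where
  "block_dual_norm B s = sqrt ((matrix_inv B *v s) \<bullet> s)"

definition weighted_norm ::
    "nat \<Rightarrow> ('m \<Rightarrow> nat) \<Rightarrow> real ^ 'm ^ 'm \<Rightarrow> (nat \<Rightarrow> real) \<Rightarrow> real ^ 'm \<Rightarrow> real" where
  "weighted_norm n blk B w x = sqrt (\<Sum>i=1..n. w i * (block_norm B (block blk i x))\<^sup>2)"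

definition gradient :: "(real ^ 'm \<Rightarrow> real) \<Rightarrow> real ^ 'm \<Rightarrow> real ^ 'm" where
  "gradient f x = (THE d. GDERIV f x :> d)"

definition partially_separable ::
    "nat \<Rightarrow> ('m \<Rightarrow> nat) \<Rightarrow> nat \<Rightarrow> (real ^ 'm \<Rightarrow> real) \<Rightarrow> bool" where
  "partially_separable n blk \<omega> f \<longleftrightarrow>
     (\<exists>\<J> g. \<J> \<subseteq> Pow {1..n} \<and> (\<forall>J\<in>\<J>. card J \<le> \<omega>) \<and>
        (\<forall>J\<in>\<J>. convex_on UNIV (g J) \<and> (\<forall>x. g J differentiable (at x)) \<and>
           (\<forall>x y. (\<forall>i\<in>J. block blk i x = block blk i y) \<longrightarrow> g J x = g J y)) \<and>
        f = (\<lambda>x. \<Sum>J\<in>\<J>. g J x))"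

definition block_lipschitz_gradient ::
    "nat \<Rightarrow> ('m \<Rightarrow> nat) \<Rightarrow> real ^ 'm ^ 'm \<Rightarrow> (nat \<Rightarrow> real) \<Rightarrow> (real ^ 'm \<Rightarrow> real) \<Rightarrow> bool" where
  "block_lipschitz_gradient n blk B L f \<longleftrightarrow>
     (\<forall>x. f differentiable (at x)) \<and>
     (\<forall>x. \<forall>i\<in>{1..n}. \<forall>t\<in>block_space blk i.
        block_dual_norm B (block blk i (gradient f (x + t)) - block blk i (gradient f x))
          \<le> L i * block_norm B t)"

text \<open>Convexity and closedness of an extended-valued function are those of its epigraph.\<close>

definition closed_convex_fun :: "(real ^ 'm) set \<Rightarrow> (real ^ 'm \<Rightarrow> ereal) \<Rightarrow> bool" where
  "closed_convex_fun V \<phi> \<longleftrightarrow>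
     (\<forall>x\<in>V. \<phi> x \<noteq> -\<infinity>) \<and>
     convex {(x, r). x \<in> V \<and> \<phi> x \<le> ereal r} \<and>
     closed {(x, r). x \<in> V \<and> \<phi> x \<le> ereal r}"

definition separable_sum ::
    "nat \<Rightarrow> ('m \<Rightarrow> nat) \<Rightarrow> (nat \<Rightarrow> real ^ 'm \<Rightarrow> ereal) \<Rightarrow> real ^ 'm \<Rightarrow> ereal" where
  "separable_sum n blk \<Psi> x = (\<Sum>i=1..n. \<Psi> i (block blk i x))"

definition domain :: "(real ^ 'm \<Rightarrow> ereal) \<Rightarrow> (real ^ 'm) set" where
  "domain \<phi> = {x. \<phi> x < \<infinity>}"

definition subdifferential :: "(real ^ 'm \<Rightarrow> ereal) \<Rightarrow> real ^ 'm \<Rightarrow> (real ^ 'm) set" where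
  "subdifferential \<phi> x = {g. \<forall>y. \<phi> y \<ge> \<phi> x + ereal (g \<bullet> (y - x))}"

text \<open>
  The strong convexity parameter is the largest admissible modulus. It is extended-valued
  because every modulus is admissible when the domain of \<open>\<phi>\<close> is a single point.
\<close>

definition strong_convexity_parameter ::
    "nat \<Rightarrow> ('m \<Rightarrow> nat) \<Rightarrow> real ^ 'm ^ 'm \<Rightarrow> (nat \<Rightarrow> real) \<Rightarrow> (real ^ 'm \<Rightarrow> ereal) \<Rightarrow> ereal" where
  "strong_convexity_parameter n blk B w \<phi> =
     Sup (ereal ` {\<mu>. 0 \<le> \<mu> \<and>
       (\<forall>x\<in>domain \<phi>. \<forall>y\<in>domain \<phi>. \<forall>g\<in>subdifferential \<phi> x.
          \<phi> y \<ge> \<phi> x + ereal (g \<bullet> (y - x) + \<mu> / 2 * (weighted_norm n blk B w (y - x))\<^sup>2))})"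

definition nice_sampling :: "nat \<Rightarrow> nat \<Rightarrow> nat set pmf" where
  "nice_sampling n \<tau> = pmf_of_set {A. A \<subseteq> {1..n} \<and> card A = \<tau>}"

definition pcdm_beta :: "nat \<Rightarrow> nat \<Rightarrow> nat \<Rightarrow> real" where
  "pcdm_beta n \<omega> \<tau> = 1 + (real \<omega> - 1) * (real \<tau> - 1) / (real n - 1)"

definition pcdm_model ::
    "nat \<Rightarrow> ('m \<Rightarrow> nat) \<Rightarrow> real ^ 'm ^ 'm \<Rightarrow> (nat \<Rightarrow> real) \<Rightarrow> real \<Rightarrow> (real ^ 'm \<Rightarrow> real) \<Rightarrow>
     (real ^ 'm \<Rightarrow> ereal) \<Rightarrow> real ^ 'm \<Rightarrow> real ^ 'm \<Rightarrow> ereal" where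
  "pcdm_model n blk B L \<beta> f \<Psi> x h =
     ereal (f x + gradient f x \<bullet> h + \<beta> / 2 * (weighted_norm n blk B L h)\<^sup>2) + \<Psi> (x + h)"

text \<open>
  \<open>S k\<close> is the sampling and \<open>X k\<close> the iterate at step \<open>k\<close>, as random variables on the probability
  space \<open>M\<close>.
\<close>

definition pcdm ::
    "nat \<Rightarrow> ('m \<Rightarrow> nat) \<Rightarrow> real ^ 'm ^ 'm \<Rightarrow> (nat \<Rightarrow> real) \<Rightarrow> nat \<Rightarrow> nat \<Rightarrow> (real ^ 'm \<Rightarrow> real) \<Rightarrow>
     (real ^ 'm \<Rightarrow> ereal) \<Rightarrow> real ^ 'm \<Rightarrow> 'a measure \<Rightarrow> (nat \<Rightarrow> 'a \<Rightarrow> nat set) \<Rightarrow>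
     (nat \<Rightarrow> 'a \<Rightarrow> real ^ 'm) \<Rightarrow> bool" where
  "pcdm n blk B L \<omega> \<tau> f \<Psi> x0 M S X \<longleftrightarrow>
     prob_space M \<and>
     prob_space.indep_vars M (\<lambda>_. count_space UNIV) S UNIV \<and>
     (\<forall>k. distr M (count_space UNIV) (S k) = measure_pmf (nice_sampling n \<tau>)) \<and>
     (\<forall>\<xi>\<in>space M. X 0 \<xi> = x0 \<and>
        (\<forall>k. \<exists>h. is_arg_min (pcdm_model n blk B L (pcdm_beta n \<omega> \<tau>) f \<Psi> (X k \<xi>)) (\<lambda>_. True) h \<and>
           X (Suc k) \<xi> = X k \<xi> + (\<Sum>i\<in>S k \<xi>. block blk i h)))"

text \<open>
  Time of one synchronous iteration on \<open>p\<close> processors, times the number of iterations, which is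
  the real-valued complexity bound without rounding.
\<close>

definition iteration_time :: "nat \<Rightarrow> nat \<Rightarrow> real" where
  "iteration_time p \<tau> = of_int \<lceil>real \<tau> / real p\<rceil>"

definition iteration_bound :: "nat \<Rightarrow> nat \<Rightarrow> real \<Rightarrow> nat \<Rightarrow> real" where
  "iteration_bound n \<omega> c \<tau> = real n / real \<tau> * pcdm_beta n \<omega> \<tau> * c"

definition total_time :: "nat \<Rightarrow> nat \<Rightarrow> nat \<Rightarrow> real \<Rightarrow> nat \<Rightarrow> real" where
  "total_time n p \<omega> c \<tau> = iteration_time p \<tau> * iteration_bound n \<omega> c \<tau>"

end

(* The content of the optimality claim is elementary: beta(tau)/tau = a/tau + b with
   a, b \<ge> 0, and the ceiling k of tau/p satisfies k \<ge> 1 and k/tau \<ge> 1/p, so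
   k (a/tau + b) \<ge> a/p + b. For c > 0 one needs that mu is finite and that F is bounded
   below. The first holds because f is finite everywhere and has subgradients; for the second,
   the block functions have affine minorants (separation from the epigraph), and the quadratic
   term of the strongly convex f dominates every affine function. *)
theory Submission
  imports Defs
begin

section \<open>Block projections and the weighted norm\<close>

lemma continuous_on_block: "continuous_on UNIV (block blk i)"
  unfolding block_def
proof (rule continuous_on_vec_lambda)
  show "continuous_on UNIV (\<lambda>x. if blk j = i then x $ j else 0)" for j
    by (cases "blk j = i") (auto intro: continuous_intros)
qed

lemma block_in_block_space: "block blk i x \<in> block_space blk i"
  by (simp add: block_def block_space_def)

lemma block_scaleR: "block blk i (r *\<^sub>R x) = r *\<^sub>R block blk i x"
  by (simp add: block_def vec_eq_iff)

lemma inner_block: "a \<bullet> block blk i x = block blk i a \<bullet> x"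
  by (auto simp: block_def inner_vec_def intro!: sum.cong)

lemma block_positive_definite_nonneg:
  assumes "block_positive_definite n blk B" "i \<in> {1..n}"
  shows "0 \<le> (B *v block blk i x) \<bullet> block blk i x"
  using assms block_in_block_space[of blk i x]
  by (cases "block blk i x = 0") (auto simp: block_positive_definite_def intro: less_imp_le)

text \<open>Squaring undoes the square roots only on nonnegative arguments, hence the hypotheses.
  The resulting quadratic form is easier to handle than the norm.\<close>

lemma weighted_norm_power2:
  assumes "block_positive_definite n blk B" "\<forall>i\<in>{1..n}. 0 < w i"
  shows "(weighted_norm n blk B w x)\<^sup>2
    = (\<Sum>i=1..n. w i * ((B *v block blk i x) \<bullet> block blk i x))"
proof -
  have "(block_norm B (block blk i x))\<^sup>2 = (B *v block blk i x) \<bullet> block blk i x"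
    if "i \<in> {1..n}" for i
    using block_positive_definite_nonneg[OF assms(1) that] by (simp add: block_norm_def)
  moreover have "0 \<le> (\<Sum>i=1..n. w i * (block_norm B (block blk i x))\<^sup>2)"
    using assms(2) by (intro sum_nonneg mult_nonneg_nonneg) (auto intro: less_imp_le)
  ultimately show ?thesis
    by (simp add: weighted_norm_def)
qed

text \<open>The squared weighted norm is a quadratic form, positive off the origin because the
  blocks cover all coordinates. Its minimum on the compact unit sphere serves as \<kappa>, and
  homogeneity of degree 2 carries the bound to all vectors.\<close>

lemma weighted_norm_coercive:
  fixes blk :: "'m::finite \<Rightarrow> nat"
  assumes blocks: "range blk = {1..n}"
    and B: "block_positive_definite n blk B"
    and w: "\<forall>i\<in>{1..n}. 0 < w i"
  obtains \<kappa> where "0 < \<kappa>" "\<And>x. \<kappa> * (norm x)\<^sup>2 \<le> (weighted_norm n blk B w x)\<^sup>2"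
proof -
  define q where "q x = (\<Sum>i=1..n. w i * ((B *v block blk i x) \<bullet> block blk i x))" for x
  have q_scale: "q (r *\<^sub>R x) = r\<^sup>2 * q x" for r x
    by (simp add: q_def block_scaleR matrix_vector_mult_scaleR sum_distrib_left power2_eq_square ac_simps)
  have q_pos: "0 < q x" if x: "x \<noteq> 0" for x
  proof -
    obtain j where j: "x $ j \<noteq> 0"
      using x by (auto simp: vec_eq_iff)
    have i: "blk j \<in> {1..n}"
      using blocks by blast
    have "block blk (blk j) x \<noteq> 0"
      using j by (auto simp: block_def vec_eq_iff)
    then have "0 < (B *v block blk (blk j) x) \<bullet> block blk (blk j) x"
      using B i block_in_block_space[of blk "blk j" x] by (auto simp: block_positive_definite_def)
    then have "0 < w (blk j) * ((B *v block blk (blk j) x) \<bullet> block blk (blk j) x)"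
      using w i by auto
    moreover have "0 \<le> w i * ((B *v block blk i x) \<bullet> block blk i x)" if "i \<in> {1..n}" for i
      using w that by (intro mult_nonneg_nonneg block_positive_definite_nonneg[OF B]) (auto intro: less_imp_le)
    \<comment> \<open>One positive summand, from the block containing a nonzero coordinate, suffices
      since the others are nonnegative.\<close>
    ultimately show ?thesis
      unfolding q_def by (intro sum_pos2[OF _ i]) auto
  qed
  have cont: "continuous_on (sphere 0 1) q"
    unfolding q_def
    by (intro continuous_intros continuous_on_subset[OF continuous_on_block]
        continuous_on_compose2[OF matrix_vector_mult_linear_continuous_on]) auto
  have "sphere (0 :: real ^ 'm) 1 \<noteq> {}"
    by (simp add: sphere_eq_empty)
  then obtain u where u: "norm u = 1" "\<And>x. norm x = 1 \<Longrightarrow> q u \<le> q x"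
    using continuous_attains_inf[OF compact_sphere _ cont] by auto
  have "q u * (norm x)\<^sup>2 \<le> q x" for x
  proof (cases "x = 0")
    case True
    then show ?thesis using q_scale[of 0 0] by simp
  next
    case False
    then have "q u \<le> q ((1 / norm x) *\<^sub>R x)"
      by (intro u) simp
    also have "\<dots> = q x / (norm x)\<^sup>2"
      by (simp add: q_scale power_divide)
    finally show ?thesis
      using False by (simp add: pos_le_divide_eq)
  qed
  moreover have "0 < q u"
    using u(1) by (intro q_pos) auto
  ultimately show ?thesis
    using that[of "q u"] by (simp add: weighted_norm_power2[OF B w] q_def)
qed

section \<open>Affine minorants and a bound for quadratics\<close>

lemma subdifferential_nonempty:
  fixes f :: "real ^ 'm \<Rightarrow> real"
  assumes convex: "convex_on UNIV f" and diff: "f differentiable (at x)"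
  obtains g where "g \<in> subdifferential (\<lambda>x. ereal (f x)) x"
proof -
  obtain D where D: "(f has_derivative D) (at x)"
    using diff by (auto simp: differentiable_def)
  then have lin: "linear D"
    by (rule has_derivative_linear)
  have "f x + D (y - x) \<le> f y" for y
  proof -
    \<comment> \<open>Restricting f to the line through x and y reduces the claim to the tangent
      inequality for convex functions of one real variable.\<close>
    define \<phi> where "\<phi> t = f (x + t *\<^sub>R (y - x))" for t
    have "convex_on UNIV \<phi>"
    proof (rule convex_onI)
      fix t a b :: real
      assume t: "0 < t" "t < 1"
      have "x + ((1 - t) *\<^sub>R a + t *\<^sub>R b) *\<^sub>R (y - x)
          = (1 - t) *\<^sub>R (x + a *\<^sub>R (y - x)) + t *\<^sub>R (x + b *\<^sub>R (y - x))"
        by (simp add: algebra_simps)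
      then show "\<phi> ((1 - t) *\<^sub>R a + t *\<^sub>R b) \<le> (1 - t) * \<phi> a + t * \<phi> b"
        unfolding \<phi>_def using convex_onD[OF convex, of t] t by simp
    qed simp
    moreover have "(\<phi> has_field_derivative D (y - x)) (at 0)"
    proof -
      have "((\<lambda>t. x + t *\<^sub>R (y - x)) has_derivative (\<lambda>t. t *\<^sub>R (y - x))) (at (0::real))"
        by (auto intro!: derivative_eq_intros)
      moreover have "(f has_derivative D) (at (x + 0 *\<^sub>R (y - x)))"
        using D by simp
      ultimately have "(\<phi> has_derivative (\<lambda>t. D (t *\<^sub>R (y - x)))) (at 0)"
        unfolding \<phi>_def by (rule has_derivative_compose)
      then show ?thesis
        by (simp add: has_field_derivative_def linear_cmul[OF lin] mult_commute_abs)
    qed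
    ultimately have "\<phi> 1 \<ge> \<phi> 0 + D (y - x) * (1 - 0)"
      using convex_on_imp_above_tangent[of UNIV \<phi> 0 1 "D (y - x)"] by simp
    then show ?thesis
      by (simp add: \<phi>_def)
  qed
  \<comment> \<open>The vector \<open>adjoint D 1\<close> represents the functional D, so it is the
    gradient of f at x.\<close>
  moreover have "adjoint D 1 \<bullet> h = D h" for h
    using adjoint_works[OF lin, of h 1] by (simp add: inner_commute)
  ultimately have "adjoint D 1 \<in> subdifferential (\<lambda>x. ereal (f x)) x"
    by (simp add: subdifferential_def)
  then show ?thesis ..
qed

text \<open>A point just below the graph is strictly separated from the closed convex epigraph. The
  separating hyperplane is not vertical, so it is the graph of an affine function.\<close>

lemma closed_convex_fun_affine_minorant:
  fixes \<phi> :: "real ^ 'm \<Rightarrow> ereal"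
  assumes \<phi>: "closed_convex_fun V \<phi>" and x: "x \<in> V" "\<phi> x < \<infinity>"
  obtains a b where "\<And>y. y \<in> V \<Longrightarrow> ereal (a \<bullet> y + b) \<le> \<phi> y"
proof -
  define E where "E = {(x, r). x \<in> V \<and> \<phi> x \<le> ereal r}"
  obtain v where v: "\<phi> x = ereal v"
    using \<phi> x by (cases "\<phi> x") (auto simp: closed_convex_fun_def)
  have "convex E" "closed E"
    using \<phi> by (auto simp: closed_convex_fun_def E_def)
  moreover have "(x, v - 1) \<notin> E"
    by (simp add: E_def v)
  ultimately obtain d \<beta> where sep: "d \<bullet> (x, v - 1) < \<beta>" "\<And>z. z \<in> E \<Longrightarrow> \<beta> < d \<bullet> z"
    using separating_hyperplane_closed_point[of E "(x, v - 1)"] by metis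
  obtain a s where d: "d = (a, s)"
    by force
  have "(x, v) \<in> E"
    using x v by (simp add: E_def)
  \<comment> \<open>The points \<open>(x, v)\<close> and \<open>(x, v - 1)\<close> lie strictly on
    opposite sides and differ only in height, which fixes the sign of s.\<close>
  from sep(2)[OF this] sep(1) have s: "0 < s"
    by (simp add: d algebra_simps)
  show ?thesis
  proof (rule that[of "- (1 / s) *\<^sub>R a" "\<beta> / s"])
    fix y assume y: "y \<in> V"
    show "ereal ((- (1 / s) *\<^sub>R a) \<bullet> y + \<beta> / s) \<le> \<phi> y"
    proof (cases "\<phi> y")
      case (real r)
      then have "(y, r) \<in> E"
        using y by (simp add: E_def)
      from sep(2)[OF this] have "\<beta> - a \<bullet> y \<le> r * s"
        by (simp add: d algebra_simps)
      then have "(\<beta> - a \<bullet> y) / s \<le> r"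
        using s by (simp add: pos_divide_le_eq)
      then show ?thesis
        using real by (simp add: diff_divide_distrib)
    next
      case MInf
      then show ?thesis
        using \<phi> y by (auto simp: closed_convex_fun_def)
    qed auto
  qed
qed

text \<open>Minorants of the block functions add up. Projecting each slope to its block turns it
  into a functional of the full vector, since block projections are self-adjoint.\<close>

lemma separable_sum_affine_minorant:
  fixes \<Psi>\<^sub>b :: "nat \<Rightarrow> real ^ 'm \<Rightarrow> ereal"
  assumes \<Psi>\<^sub>b: "\<forall>i\<in>{1..n}. closed_convex_fun (block_space blk i) (\<Psi>\<^sub>b i)"
    and x: "separable_sum n blk \<Psi>\<^sub>b x \<noteq> \<infinity>"
  obtains a b where "\<And>y. ereal (a \<bullet> y + b) \<le> separable_sum n blk \<Psi>\<^sub>b y"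
proof -
  have "\<exists>a b. \<forall>y\<in>block_space blk i. ereal (a \<bullet> y + b) \<le> \<Psi>\<^sub>b i y" if i: "i \<in> {1..n}" for i
  proof -
    \<comment> \<open>An infinite summand would make the whole sum infinite. Thus each block
      function is finite somewhere, as the separation argument requires.\<close>
    have "\<Psi>\<^sub>b i (block blk i x) \<noteq> \<infinity>"
      using x i by (auto simp: separable_sum_def sum_Pinfty)
    then have "\<Psi>\<^sub>b i (block blk i x) < \<infinity>"
      by simp
    with \<Psi>\<^sub>b i show ?thesis
      by (meson closed_convex_fun_affine_minorant block_in_block_space)
  qed
  then obtain a b where ab:
    "\<And>i y. i \<in> {1..n} \<Longrightarrow> y \<in> block_space blk i \<Longrightarrow> ereal (a i \<bullet> y + b i) \<le> \<Psi>\<^sub>b i y"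
    by metis
  show ?thesis
  proof (rule that[of "\<Sum>i=1..n. block blk i (a i)" "\<Sum>i=1..n. b i"])
    fix y
    have "ereal ((\<Sum>i=1..n. block blk i (a i)) \<bullet> y + (\<Sum>i=1..n. b i))
        = (\<Sum>i=1..n. ereal (a i \<bullet> block blk i y + b i))"
      by (simp add: inner_sum_left inner_block sum.distrib)
    also have "\<dots> \<le> separable_sum n blk \<Psi>\<^sub>b y"
      unfolding separable_sum_def by (intro sum_mono ab block_in_block_space)
    finally show "ereal ((\<Sum>i=1..n. block blk i (a i)) \<bullet> y + (\<Sum>i=1..n. b i))
        \<le> separable_sum n blk \<Psi>\<^sub>b y" .
  qed
qed

text \<open>Cauchy-Schwarz reduces this to a quadratic in \<open>norm z\<close>, and completing the
  square gives the constant.\<close>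

lemma quadratic_plus_linear_bounded_below:
  fixes G z :: "'a::real_inner"
  assumes "0 < \<kappa>"
  shows "- ((norm G)\<^sup>2 / (4 * \<kappa>)) \<le> G \<bullet> z + \<kappa> * (norm z)\<^sup>2"
proof -
  have "0 \<le> (2 * \<kappa> * norm z - norm G)\<^sup>2 / (4 * \<kappa>)"
    using assms by simp
  also have "\<dots> = \<kappa> * (norm z)\<^sup>2 - norm G * norm z + (norm G)\<^sup>2 / (4 * \<kappa>)"
    using assms by (simp add: power2_eq_square field_simps)
  finally show ?thesis
    using Cauchy_Schwarz_ineq2[of G z] by linarith
qed

section \<open>Comparison of the total times\<close>

lemma pcdm_total_time_optimal:
  assumes n: "1 < n" and \<omega>: "\<omega> \<in> {1..n}" and p: "p \<in> {1..n}" and \<tau>: "\<tau> \<in> {1..n}" and c: "0 \<le> c"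
  shows "total_time n p \<omega> c p \<le> total_time n p \<omega> c \<tau>"
proof -
  define b where "b = (real \<omega> - 1) / (real n - 1)"
  \<comment> \<open>Both bounds come from \<omega> lying between 1 and n; they make the two
    coefficients \<open>1 - b\<close> and \<open>b\<close> nonnegative.\<close>
  have b: "0 \<le> b" "b \<le> 1"
    using n \<omega> by (auto simp: b_def divide_simps)
  define k where "k = iteration_time p \<tau>"
  have beta: "pcdm_beta n \<omega> t / real t = (1 - b) / real t + b" if "t \<in> {1..n}" for t
  proof -
    have "pcdm_beta n \<omega> t = (1 - b) + b * real t"
      by (simp add: pcdm_beta_def b_def algebra_simps diff_divide_distrib add_divide_distrib)
    then show ?thesis
      using that by (simp add: add_divide_distrib)
  qed
  have total: "total_time n p \<omega> c t = n * c * (iteration_time p t * ((1 - b) / real t + b))"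
    if "t \<in> {1..n}" for t
    by (simp add: total_time_def iteration_bound_def beta[OF that, symmetric])
  have k_ge: "real \<tau> / real p \<le> k"
    by (simp add: k_def iteration_time_def)
  have "0 < real \<tau> / real p"
    using \<tau> p by simp
  then have "1 \<le> \<lceil>real \<tau> / real p\<rceil>"
    by linarith
  then have "1 \<le> k"
    by (simp add: k_def iteration_time_def)
  have "1 / real p \<le> k / real \<tau>"
    using k_ge \<tau> p by (simp add: field_simps)
  then have "(1 - b) * (1 / real p) + 1 * b \<le> (1 - b) * (k / real \<tau>) + k * b"
    using b \<open>1 \<le> k\<close> by (intro add_mono mult_left_mono mult_right_mono) auto
  then have "(1 - b) / real p + b \<le> k * ((1 - b) / real \<tau> + b)"
    by (simp add: algebra_simps)
  \<comment> \<open>With \<tau> = p the ceiling is exactly 1, so the lower bound just proved is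
    attained.\<close>
  moreover have "iteration_time p p = 1"
    using p by (simp add: iteration_time_def)
  ultimately show ?thesis
    using c by (simp add: total[OF p] total[OF \<tau>] k_def mult_left_mono)
qed

section \<open>Positivity of c and optimality of \<tau> = p\<close>

theorem theorem14:
  fixes n p \<omega> :: nat
    and blk :: "'m::finite \<Rightarrow> nat"
    and B :: "real ^ 'm ^ 'm"
    and L :: "nat \<Rightarrow> real"
    and f :: "real ^ 'm \<Rightarrow> real"
    and \<Psi>\<^sub>b :: "nat \<Rightarrow> real ^ 'm \<Rightarrow> ereal"
    and \<Psi> F :: "real ^ 'm \<Rightarrow> ereal"
    and Fmin \<mu> :: ereal
    and x0 :: "real ^ 'm"
    and \<epsilon> \<rho> c :: real
    and M :: "nat \<Rightarrow> 'a measure"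
    and S :: "nat \<Rightarrow> nat \<Rightarrow> 'a \<Rightarrow> nat set"
    and X :: "nat \<Rightarrow> nat \<Rightarrow> 'a \<Rightarrow> real ^ 'm"
  assumes n: "1 < n"
    and blocks: "range blk = {1..n}"
    and B: "block_positive_definite n blk B"
    and f_convex: "convex_on UNIV f"
    and \<omega>: "\<omega> \<in> {1..n}"
    and f_separable: "partially_separable n blk \<omega> f"
    and L_pos: "\<forall>i\<in>{1..n}. 0 < L i"
    and f_lipschitz: "block_lipschitz_gradient n blk B L f"
    and \<Psi>\<^sub>b: "\<forall>i\<in>{1..n}. closed_convex_fun (block_space blk i) (\<Psi>\<^sub>b i)"
    and \<Psi>: "\<Psi> = separable_sum n blk \<Psi>\<^sub>b"
    and F: "F = (\<lambda>x. ereal (f x) + \<Psi> x)"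
    and Fmin: "Fmin = (INF x. F x)"
    and \<mu>: "\<mu> = strong_convexity_parameter n blk B L F"
    and \<mu>_eq: "\<mu> = strong_convexity_parameter n blk B L (\<lambda>x. ereal (f x))"
    and \<mu>_pos: "0 < \<mu>"
    and x0: "x0 \<in> domain F"
    and \<epsilon>: "0 < \<epsilon>" "ereal \<epsilon> < F x0 - Fmin"
    and \<rho>: "\<rho> \<in> {0<..<1}"
    and p: "p \<in> {1..n}"
    and methods: "\<forall>\<tau>\<in>{1..n}. pcdm n blk B L \<omega> \<tau> f \<Psi> x0 (M \<tau>) (S \<tau>) (X \<tau>)"
    and c: "c = 1 / real_of_ereal \<mu> * ln (real_of_ereal (F x0 - Fmin) / (\<epsilon> * \<rho>))"
  shows "0 < c \<and> is_arg_min (total_time n p \<omega> c) (\<lambda>\<tau>. \<tau> \<in> {1..n}) p"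
proof -
  have f_diff: "\<And>x. f differentiable (at x)"
    using f_lipschitz by (simp add: block_lipschitz_gradient_def)
  obtain \<kappa> where \<kappa>: "0 < \<kappa>" "\<And>x. \<kappa> * (norm x)\<^sup>2 \<le> (weighted_norm n blk B L x)\<^sup>2"
    using weighted_norm_coercive[OF blocks B L_pos] by blast
  obtain g where g: "g \<in> subdifferential (\<lambda>x. ereal (f x)) x0"
    using subdifferential_nonempty[OF f_convex f_diff] .
  \<comment> \<open>The admissible moduli of f rather than of F: f is finite everywhere, so its
    inequality may be tested at every point.\<close>
  define A where "A = {m. 0 \<le> m \<and>
       (\<forall>x\<in>domain (\<lambda>x. ereal (f x)). \<forall>y\<in>domain (\<lambda>x. ereal (f x)).
          \<forall>g\<in>subdifferential (\<lambda>x. ereal (f x)) x.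
          ereal (f y) \<ge> ereal (f x)
            + ereal (g \<bullet> (y - x) + m / 2 * (weighted_norm n blk B L (y - x))\<^sup>2))}"
  have \<mu>_A: "\<mu> = Sup (ereal ` A)"
    unfolding \<mu>_eq strong_convexity_parameter_def A_def ..
  have strong: "f x0 + g \<bullet> (y - x0) + m * \<kappa> / 2 * (norm (y - x0))\<^sup>2 \<le> f y" if m: "m \<in> A" for m y
  proof -
    have "f x0 + (g \<bullet> (y - x0) + m / 2 * (weighted_norm n blk B L (y - x0))\<^sup>2) \<le> f y"
      using m g by (auto simp: A_def domain_def)
    moreover have "m / 2 * (\<kappa> * (norm (y - x0))\<^sup>2) \<le> m / 2 * (weighted_norm n blk B L (y - x0))\<^sup>2"
      using m by (intro mult_left_mono \<kappa>) (auto simp: A_def)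
    ultimately show ?thesis
      by (simp add: algebra_simps)
  qed

  \<comment> \<open>Testing the inequality at distance 1 from x0 bounds all moduli at once, so \<mu>
    is finite. An infinite \<mu> would be sent to 0 by \<open>real_of_ereal\<close>, making c
    zero.\<close>
  obtain e :: "real ^ 'm" where e: "norm e = 1"
    using vector_choose_size[of 1] by auto
  have "m \<le> 2 * (f (x0 + e) - f x0 - g \<bullet> e) / \<kappa>" if "m \<in> A" for m
    using strong[OF that, of "x0 + e"] \<kappa>(1) e by (simp add: field_simps)
  then have "\<mu> \<le> ereal (2 * (f (x0 + e) - f x0 - g \<bullet> e) / \<kappa>)"
    unfolding \<mu>_A by (intro Sup_least) auto
  then have "\<mu> \<noteq> \<infinity>"
    by auto
  then have \<mu>_real: "0 < real_of_ereal \<mu>"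
    using \<mu>_pos by (cases \<mu>) auto

  have \<Psi>_x0: "separable_sum n blk \<Psi>\<^sub>b x0 \<noteq> \<infinity>"
    using x0 by (auto simp: F \<Psi> domain_def)
  obtain a b where ab: "\<And>y. ereal (a \<bullet> y + b) \<le> \<Psi> y"
    using separable_sum_affine_minorant[OF \<Psi>\<^sub>b \<Psi>_x0] unfolding \<Psi> by blast
  \<comment> \<open>A positive supremum yields some positive modulus; whether the supremum is
    attained does not matter.\<close>
  obtain m where m: "m \<in> A" "0 < m"
    using \<mu>_pos unfolding \<mu>_A by (auto simp: less_Sup_iff)
  \<comment> \<open>The strong convexity bound for f plus the affine minorant of \<Psi> is a
    quadratic in \<open>y - x0\<close> with slope \<open>g + a\<close> and leading coefficient
    \<open>m * \<kappa> / 2\<close>; C is the lower bound for it from completing the square.\<close>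
  define C where "C = f x0 + a \<bullet> x0 + b - (norm (g + a))\<^sup>2 / (4 * (m * \<kappa> / 2))"
  have F_ge: "ereal C \<le> F y" for y
  proof -
    have "C \<le> f x0 + a \<bullet> x0 + b + ((g + a) \<bullet> (y - x0) + m * \<kappa> / 2 * (norm (y - x0))\<^sup>2)"
      using quadratic_plus_linear_bounded_below[of "m * \<kappa> / 2" "g + a" "y - x0"] m \<kappa>
      by (simp add: C_def)
    also have "\<dots> \<le> f y + (a \<bullet> y + b)"
      using strong[OF m(1), of y] by (simp add: inner_add_left inner_diff_right)
    finally have "ereal C \<le> ereal (f y) + ereal (a \<bullet> y + b)"
      by simp
    also have "\<dots> \<le> F y"
      unfolding F by (intro add_left_mono ab)
    finally show ?thesis .
  qed
  have "ereal C \<le> Fmin"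
    unfolding Fmin by (intro INF_greatest F_ge)
  moreover have "Fmin \<le> F x0"
    unfolding Fmin by (intro INF_lower) simp
  ultimately obtain r s where r: "F x0 = ereal r" and s: "Fmin = ereal s"
    using x0 F_ge[of x0] by (cases "F x0"; cases Fmin) (auto simp: domain_def)
  \<comment> \<open>The chain puts the argument of the logarithm above 1, so the logarithm is
    positive.\<close>
  have "\<epsilon> * \<rho> < \<epsilon>"
    using \<epsilon>(1) \<rho> by simp
  also have "\<epsilon> < r - s"
    using \<epsilon>(2) by (simp add: r s)
  finally have "1 < (r - s) / (\<epsilon> * \<rho>)"
    using \<epsilon>(1) \<rho> by simp
  then have "0 < c"
    using \<mu>_real by (simp add: c r s)
  moreover have "is_arg_min (total_time n p \<omega> c) (\<lambda>\<tau>. \<tau> \<in> {1..n}) p"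
    using p pcdm_total_time_optimal[OF n \<omega> p] \<open>0 < c\<close> by (auto simp: is_arg_min_def not_less)
  ultimately show ?thesis ..
qed

end
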